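(* Let $0 < t \leq 1$ and $a > 0$. Then the function $K_{t,a} : \mathbb{R} \times \mathbb{R} \to \mathbb{R}$, $$K_{t,a}(x,y) = \frac{1}{\pi}\cdot\frac{1}{1 + (x-y)^2 + a(x^2+y^2)^t},$$ is a positive-definite kernel; hence the integral operator $\mathbf{K}_{t,a}$ on $L^2(\mathbb{R})$ with kernel $K_{t,a}$ is a positive-definite operator.
   Context: For $t>0$, $a>0$, the operator $\mathbf{K}_{t,a} : L^2(\mathbb{R}) \to L^2(\mathbb{R})$ (complex-valued functions) is defined by $\mathbf{K}_{t,a}[c](x) = \int_{\mathbb{R}} K_{t,a}(x,y)\, c(y)\, dy$; it is a bounded (indeed compact) operator on $L^2(\mathbb{R})$. For a nonempty set $X$, a function $K : X \times X \to \mathbb{C}$ is called a positive-definite kernel if $\sum_{j=1}^n \sum_{k=1}^n c_j \overline{c_k} K(x_j,x_k) \geq 0$ for all $n \in \mathbb{N} = \{1,2,\dots\}$, all $(x_1,\dots,x_n) \in X^n$ and all $(c_1,\dots,c_n)\in\mathbb{C}^n$ (so "positive-definite" is meant in the non-strict sense). The operator $\mathbf{K}_{t,a}$ is called positive-definite if $\langle \mathbf{K}_{t,a}[c], c\rangle = \iint_{\mathbb{R}\times\mathbb{R}} K_{t,a}(x,y)\, c(x)\overline{c(y)}\, dy\, dx \geq 0$ for all $c \in L^2(\mathbb{R})$. Convention: $0^t = 0$ for $t>0$. *)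

theory Defs
  imports "HOL-Analysis.Analysis"
begin

text \<open>The convention that zero to a positive power is zero is already that of \<^term>\<open>(powr)\<close>.\<close>

definition K_kernel :: "real \<Rightarrow> real \<Rightarrow> real \<Rightarrow> real \<Rightarrow> real" where
  "K_kernel t a x y = 1 / pi * (1 / (1 + (x - y)\<^sup>2 + a * (x\<^sup>2 + y\<^sup>2) powr t))"

text \<open>Positive-definiteness is meant in the non-strict sense, and the points \<^term>\<open>x j\<close> need not be
  distinct. The nonempty underlying set is the whole type \<^typ>\<open>'a\<close>. Membership in
  \<^term>\<open>\<real>\<^sub>\<ge>\<^sub>0 :: complex set\<close> says that the complex number is real and nonnegative.\<close>

definition positive_definite_kernel :: "('a \<Rightarrow> 'a \<Rightarrow> complex) \<Rightarrow> bool" where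
  "positive_definite_kernel K \<longleftrightarrow>
     (\<forall>n\<ge>1. \<forall>(x :: nat \<Rightarrow> 'a) (c :: nat \<Rightarrow> complex).
        (\<Sum>j=1..n. \<Sum>k=1..n. c j * cnj (c k) * K (x j) (x k)) \<in> \<real>\<^sub>\<ge>\<^sub>0)"

text \<open>Elements of the complex space of square-integrable functions on the line are given by
  Borel-measurable representatives (every class modulo null sets has one); everything below is
  invariant under changing a representative on a null set.\<close>

definition L2 :: "(real \<Rightarrow> complex) set" where
  "L2 = {f \<in> borel_measurable lborel. integrable lborel (\<lambda>x. (cmod (f x))\<^sup>2)}"

definition L2_inner :: "(real \<Rightarrow> complex) \<Rightarrow> (real \<Rightarrow> complex) \<Rightarrow> complex" where
  "L2_inner f g = (\<integral>x. f x * cnj (g x) \<partial>lborel)"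

definition integral_operator ::
    "(real \<Rightarrow> real \<Rightarrow> complex) \<Rightarrow> (real \<Rightarrow> complex) \<Rightarrow> (real \<Rightarrow> complex)" where
  "integral_operator K c = (\<lambda>x. \<integral>y. K x y * c y \<partial>lborel)"

text \<open>The Bochner integral of a non-integrable function is 0 by convention, so that
  \<^const>\<open>integral_operator\<close> and \<^const>\<open>L2_inner\<close> are meaningful only under a convergence condition.
  The next predicate provides it: the defining integrals converge absolutely and the operator maps
  square-integrable functions to square-integrable functions.\<close>

definition defines_operator_on_L2 :: "(real \<Rightarrow> real \<Rightarrow> complex) \<Rightarrow> bool" where
  "defines_operator_on_L2 K \<longleftrightarrow>
     (\<forall>c\<in>L2. (AE x in lborel. integrable lborel (\<lambda>y. K x y * c y)) \<and> integral_operator K c \<in> L2)"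

definition positive_definite_operator :: "((real \<Rightarrow> complex) \<Rightarrow> (real \<Rightarrow> complex)) \<Rightarrow> bool" where
  "positive_definite_operator T \<longleftrightarrow> (\<forall>c\<in>L2. L2_inner (T c) c \<in> \<real>\<^sub>\<ge>\<^sub>0)"

end

theory Submission
  imports Defs "HOL-Probability.Sinc_Integral" "HOL-Real_Asymp.Real_Asymp"
begin

text \<open>Positive-definiteness survives sums, products and pointwise limits, so it is enough to build the
  kernel \<open>1 / (1 + (x - y)\<^sup>2 + a (x\<^sup>2 + y\<^sup>2)\<^sup>t)\<close>, by these operations, from kernels \<open>f x * f y\<close>.

  The power \<open>r\<^sup>t\<close>, with \<open>r = x\<^sup>2 + y\<^sup>2\<close>, is the limit, as \<open>e\<close> tends to 0 from above, of
  \<open>((1 - w) / e)\<^sup>t\<close> with \<open>w = exp (- e (r + e))\<close>, and \<open>w\<close> is a rank-one kernel with values in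
  \<open>(0, 1)\<close>. Since \<open>0 < t \<le> 1\<close>, all coefficients of positive index in the binomial series of
  \<open>1 - (1 - w)\<^sup>t\<close> are nonnegative, so this kernel \<open>S\<close> is positive-definite. Expanding
  \<open>(x - y)\<^sup>2\<close> as well, the denominator with \<open>r\<^sup>t\<close> so replaced becomes \<open>h x + h y - Q x y\<close>, where
  \<open>Q x y = 2 x y + b S x y\<close> is positive-definite, \<open>h x = 1/2 + x\<^sup>2 + b/2\<close> and \<open>b = a / e\<^sup>t\<close>.
  Its reciprocal is the geometric series
  \<open>\<Sum>k. Q\<^sup>k / (h x + h y)\<^sup>k\<^sup>+\<^sup>1\<close>, and the Cauchy kernel \<open>1 / (h x + h y)\<close> is itself
  positive-definite by another geometric series (lemmas \<open>pd_cone_weighted_Cauchy\<close>,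
  \<open>pd_cone_reciprocal\<close>, \<open>pd_cone_one_minus_powr\<close>). Letting \<open>e\<close> tend to 0 gives the kernel.

  All partial sums and limits in this construction are uniformly bounded, and all rank-one factors are
  bounded and measurable. Dominated convergence therefore carries the positivity of the double integral
  of \<open>c x * cnj (c y) * K x y\<close> from rank-one kernels, where it is \<open>\<bar>\<integral>c f\<bar>\<^sup>2\<close>, to \<open>K\<close>, for every
  integrable \<open>c\<close> on any sigma-finite space (lemma \<open>pd_cone_quadratic_form\<close>). Counting measure on finitely many
  indices gives the positive-definite kernel. For square-integrable \<open>c\<close> on the line, \<open>c\<close> is truncated
  to intervals \<open>[-n, n]\<close>. The passage to the limit, and the fact that the operator acts on square-integrable
  functions, both come from \<open>0 \<le> K x y \<le> g (x - y)\<close> with \<open>g\<close> the Cauchy density.\<close>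

section \<open>A cone of bounded positive-definite kernels\<close>

text \<open>The uniform bounds in the rules \<open>rank_one\<close> and \<open>limit\<close> are what makes dominated convergence
  applicable to quadratic forms. Generating the cone from rank-one kernels makes it closed
  under products by a mere rule induction, so that the Schur product theorem for matrices is bypassed.\<close>

inductive pd_cone :: "'a measure \<Rightarrow> ('a \<Rightarrow> 'a \<Rightarrow> real) \<Rightarrow> bool" for M :: "'a measure" where
  rank_one: "f \<in> borel_measurable M \<Longrightarrow> (\<And>x. \<bar>f x\<bar> \<le> B) \<Longrightarrow> pd_cone M (\<lambda>x y. f x * f y)"
| add: "pd_cone M K \<Longrightarrow> pd_cone M L \<Longrightarrow> pd_cone M (\<lambda>x y. K x y + L x y)"
| limit: "(\<And>n. pd_cone M (A n)) \<Longrightarrow> (\<And>n x y. \<bar>A n x y\<bar> \<le> B) \<Longrightarrow>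
    (\<And>x y. (\<lambda>n. A n x y) \<longlonglongrightarrow> K x y) \<Longrightarrow> pd_cone M K"

lemma pd_cone_bounded:
  assumes "pd_cone M K"
  shows "\<exists>B. \<forall>x y. \<bar>K x y\<bar> \<le> B"
  using assms
proof induction
  case (rank_one f B)
  have "\<bar>f x * f y\<bar> \<le> B * B" for x y
    unfolding abs_mult using rank_one(2)[of x] rank_one(2)[of y] by (intro mult_mono) auto
  then show ?case by blast
next
  case (add K L)
  then obtain B C where "\<And>x y. \<bar>K x y\<bar> \<le> B" "\<And>x y. \<bar>L x y\<bar> \<le> C" by blast
  then have "\<bar>K x y + L x y\<bar> \<le> B + C" for x y
    by (meson abs_triangle_ineq add_mono order_trans)
  then show ?case by blast
next
  case (limit A B K)
  have "\<bar>K x y\<bar> \<le> B" for x y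
    using tendsto_rabs[OF limit(3)[of x y]] limit(2)
    by (intro LIMSEQ_le_const2[of "\<lambda>n. \<bar>A n x y\<bar>"]) auto
  then show ?case by blast
qed

text \<open>The product of two rank-one kernels has rank one; sums and limits are preserved when one factor is
  held fixed, since a fixed member of the cone is bounded.\<close>

lemma pd_cone_mult:
  assumes "pd_cone M K" "pd_cone M L"
  shows "pd_cone M (\<lambda>x y. K x y * L x y)"
  using assms(1)
proof induction
  case (rank_one f B)
  note f = rank_one
  show ?case using assms(2)
  proof induction
    case (rank_one g C)
    have "\<bar>f x * g x\<bar> \<le> B * C" for x
      unfolding abs_mult using f(2)[of x] rank_one(2)[of x] by (intro mult_mono) auto
    then have "pd_cone M (\<lambda>x y. (f x * g x) * (f y * g y))"
      using f(1) rank_one(1) by (intro pd_cone.rank_one) auto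
    then show ?case by (simp add: mult_ac)
  next
    case (add K L)
    then show ?case by (auto simp: distrib_left intro: pd_cone.add)
  next
    case (limit A C K)
    have "\<bar>f x * f y * A n x y\<bar> \<le> B * B * C" for n x y
      unfolding abs_mult using f(2)[of x] f(2)[of y] limit(2)[of n x y]
      by (intro mult_mono) auto
    then show ?case
      by (rule pd_cone.limit[where A = "\<lambda>n x y. f x * f y * A n x y", OF limit(4)])
         (intro tendsto_intros limit(3))
  qed
next
  case (add K L')
  then show ?case by (auto simp: distrib_right intro: pd_cone.add)
next
  case (limit A B K)
  obtain C where C: "\<And>x y. \<bar>L x y\<bar> \<le> C" using pd_cone_bounded[OF assms(2)] by blast
  have "\<bar>A n x y * L x y\<bar> \<le> B * C" for n x y
    unfolding abs_mult using limit(2)[of n x y] C[of x y] by (intro mult_mono) auto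
  then show ?case
    by (rule pd_cone.limit[where A = "\<lambda>n x y. A n x y * L x y", OF limit(4)])
       (intro tendsto_intros limit(3))
qed

lemma pd_cone_const: "c \<ge> 0 \<Longrightarrow> pd_cone M (\<lambda>x y. c)"
  using pd_cone.rank_one[of "\<lambda>_. sqrt c" M "sqrt c"] by simp

lemma pd_cone_scale: "pd_cone M K \<Longrightarrow> c \<ge> 0 \<Longrightarrow> pd_cone M (\<lambda>x y. c * K x y)"
  using pd_cone_mult[OF pd_cone_const] .

lemma pd_cone_power: "pd_cone M K \<Longrightarrow> pd_cone M (\<lambda>x y. K x y ^ n)"
proof (induction n)
  case 0
  show ?case using pd_cone_const[of 1 M] by simp
next
  case (Suc n)
  then show ?case using pd_cone_mult[OF Suc.prems Suc.IH] by simp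
qed

lemma pd_cone_sum: "(\<And>i. pd_cone M (A i)) \<Longrightarrow> pd_cone M (\<lambda>x y. \<Sum>i<n. A i x y)" for n :: nat
proof (induction n)
  case 0
  show ?case using pd_cone_const[of 0 M] by simp
next
  case (Suc n)
  then show ?case using pd_cone.add[OF Suc.IH Suc.prems] by simp
qed

lemma pd_cone_series:
  assumes "\<And>i. pd_cone M (A i)" and "\<And>n x y. \<bar>\<Sum>i<n. A i x y\<bar> \<le> B"
    and "\<And>x y. (\<lambda>i. A i x y) sums K x y"
  shows "pd_cone M K"
proof (rule pd_cone.limit)
  show "pd_cone M (\<lambda>x y. \<Sum>i<n. A i x y)" for n
    using assms(1) by (rule pd_cone_sum)
  show "(\<lambda>n. \<Sum>i<n. A i x y) \<longlonglongrightarrow> K x y" for x y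
    using assms(3) by (simp add: sums_def)
qed (rule assms(2))

section \<open>Reciprocals and fractional powers by power series\<close>

text \<open>The Cayley transform \<open>z = (h - 1/2) / (h + 1/2)\<close> maps \<open>[1/2, \<infinity>)\<close> into \<open>[0, 1)\<close> and turns
  the Cauchy kernel into a geometric series of rank-one kernels:
  \<open>h x + h y = (h x + 1/2) (h y + 1/2) (1 - z x z y)\<close>. The weight \<open>f\<close> may be unbounded; the
  growth condition bounds both the rank-one factors and the partial sums by 1.\<close>

lemma pd_cone_weighted_Cauchy:
  fixes f h :: "'a \<Rightarrow> real"
  assumes [measurable]: "f \<in> borel_measurable M" "h \<in> borel_measurable M"
    and h: "\<And>x. h x \<ge> 1/2" and f: "\<And>x. (f x)\<^sup>2 \<le> 2 * h x"
  shows "pd_cone M (\<lambda>x y. f x * f y / (h x + h y))"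
proof -
  define z where "z x = (h x - 1/2) / (h x + 1/2)" for x
  define g where "g x = f x / (h x + 1/2)" for x
  have z: "0 \<le> z x" "z x < 1" for x using h[of x] by (auto simp: z_def field_simps)
  have zz: "0 \<le> z x * z y" "z x * z y < 1" for x y
  proof -
    show "z x * z y < 1" using mult_strict_mono'[of "z x" 1 "z y" 1] z by simp
  qed (use z in simp)
  have g: "\<bar>g x\<bar> \<le> 1" for x
  proof -
    have "0 \<le> (\<bar>f x\<bar> - 1)\<^sup>2" by simp
    then have "2 * \<bar>f x\<bar> \<le> (f x)\<^sup>2 + 1" by (simp add: power2_diff)
    then show ?thesis using f[of x] h[of x] by (simp add: g_def abs_if field_simps split: if_splits)
  qed
  have ff: "\<bar>f x * f y\<bar> \<le> h x + h y" for x y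
  proof -
    have "0 \<le> (\<bar>f x\<bar> - \<bar>f y\<bar>)\<^sup>2" by simp
    then have "2 * \<bar>f x * f y\<bar> \<le> (f x)\<^sup>2 + (f y)\<^sup>2" by (simp add: power2_diff abs_mult)
    then show ?thesis using f[of x] f[of y] by linarith
  qed
  have closed: "g x * g y / (1 - z x * z y) = f x * f y / (h x + h y)" for x y
  proof -
    have p: "h x + 1/2 > 0" "h y + 1/2 > 0" "h x + h y > 0" using h[of x] h[of y] by auto
    have "1 - z x * z y = (h x + h y) / ((h x + 1/2) * (h y + 1/2))"
      using p by (simp add: z_def divide_simps) (simp add: algebra_simps)
    then show ?thesis using p by (simp add: g_def)
  qed
  let ?A = "\<lambda>i x y. g x * g y * (z x * z y) ^ i"
  show ?thesis
  proof (rule pd_cone_series)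
    fix i :: nat
    have "\<bar>g x * z x ^ i\<bar> \<le> 1" for x
      using mult_mono[OF g[of x] power_le_one[of "z x" i]] z[of x] by (simp add: abs_mult)
    then have "pd_cone M (\<lambda>x y. (g x * z x ^ i) * (g y * z y ^ i))"
      unfolding g_def z_def by (intro pd_cone.rank_one) (simp, measurable)
    then show "pd_cone M (?A i)" by (simp add: power_mult_distrib mult_ac)
  next
    fix n :: nat and x y
    have p: "h x + h y > 0" using h[of x] h[of y] by auto
    have "(\<Sum>i<n. ?A i x y) = g x * g y / (1 - z x * z y) * (1 - (z x * z y) ^ n)"
      using zz(2)[of x y] by (simp add: sum_distrib_left[symmetric] sum_gp_strict)
    also have "\<dots> = f x * f y / (h x + h y) * (1 - (z x * z y) ^ n)" by (simp add: closed)
    also have "\<bar>\<dots>\<bar> \<le> 1 * 1"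
      unfolding abs_mult using ff[of x y] p zz[of x y]
      by (intro mult_mono) (auto simp: power_le_one)
    finally show "\<bar>\<Sum>i<n. ?A i x y\<bar> \<le> 1" by simp
  next
    fix x y
    show "(\<lambda>i. ?A i x y) sums (f x * f y / (h x + h y))"
      using sums_mult[OF geometric_sums[of "z x * z y"], of "g x * g y"] zz[of x y]
      by (simp add: closed[symmetric])
  qed
qed

text \<open>With \<open>V = 1 / (h x + h y)\<close> and \<open>W = V Q\<close>, the reciprocal is \<open>V / (1 - W) = \<Sum>k. V W\<^sup>k\<close>. The
  bound on \<open>Q\<close> says \<open>\<bar>W\<bar> \<le> 1 - V\<close>, which makes the series converge with all partial sums
  bounded by 1 although \<open>\<bar>W\<bar>\<close> need not stay away from 1. Membership in the cone is assumed for
  \<open>W\<close> and not for \<open>Q\<close>, since \<open>Q\<close> may be unbounded.\<close>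

lemma pd_cone_reciprocal:
  fixes h :: "'a \<Rightarrow> real"
  assumes "h \<in> borel_measurable M" and h: "\<And>x. h x \<ge> 1/2"
    and Q: "pd_cone M (\<lambda>x y. Q x y / (h x + h y))"
    and bound: "\<And>x y. \<bar>Q x y\<bar> \<le> h x + h y - 1"
  shows "pd_cone M (\<lambda>x y. 1 / (h x + h y - Q x y))"
proof -
  define V where "V x y = 1 / (h x + h y)" for x y
  define W where "W x y = Q x y / (h x + h y)" for x y
  have p: "h x + h y > 0" for x y using h[of x] h[of y] by auto
  have W: "\<bar>W x y\<bar> \<le> 1 - V x y" for x y
    using bound[of x y] p[of x y] by (simp add: W_def V_def divide_simps)
  have V: "V x y > 0" for x y using p by (simp add: V_def)
  have VW: "V x y / (1 - W x y) = 1 / (h x + h y - Q x y)" for x y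
    using p[of x y] by (simp add: V_def W_def divide_simps)
  show ?thesis
  proof (rule pd_cone_series)
    have "pd_cone M V"
      unfolding V_def using pd_cone_weighted_Cauchy[of "\<lambda>_. 1" M h, OF _ assms(1) h] h
      by (auto simp: field_simps)
    then show "pd_cone M (\<lambda>x y. V x y * W x y ^ i)" for i
      using Q unfolding W_def by (intro pd_cone_mult pd_cone_power)
  next
    fix n :: nat and x y
    have "\<bar>\<Sum>i<n. V x y * W x y ^ i\<bar> \<le> (\<Sum>i<n. V x y * \<bar>W x y\<bar> ^ i)"
      using V[of x y] by (intro order_trans[OF sum_abs]) (simp add: abs_mult power_abs)
    also have "\<dots> = V x y / (1 - \<bar>W x y\<bar>) * (1 - \<bar>W x y\<bar> ^ n)"
      using W[of x y] V[of x y] by (simp add: sum_distrib_left[symmetric] sum_gp_strict)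
    also have "\<dots> \<le> 1 * 1"
      using W[of x y] V[of x y] by (intro mult_mono) (auto simp: power_le_one)
    finally show "\<bar>\<Sum>i<n. V x y * W x y ^ i\<bar> \<le> 1" by simp
  next
    fix x y
    show "(\<lambda>i. V x y * W x y ^ i) sums (1 / (h x + h y - Q x y))"
      using sums_mult[OF geometric_sums[of "W x y"], of "V x y"] W[of x y] V[of x y]
      by (simp add: VW[symmetric])
  qed
qed

text \<open>For \<open>0 \<le> t \<le> 1\<close>, passing from one binomial coefficient of \<open>t\<close> of positive index to the next
  multiplies it by a nonpositive factor \<open>(t - k) / (k + 1)\<close>, so these coefficients alternate in sign. This is
  where the hypothesis \<open>t \<le> 1\<close> enters.\<close>

lemma signed_gbinomial_nonneg:
  fixes t :: real
  assumes "0 \<le> t" "t \<le> 1"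
  shows "(t gchoose Suc k) * (-1) ^ k \<ge> 0"
proof (induction k)
  case 0
  then show ?case using assms by simp
next
  case (Suc k)
  have rec: "(t gchoose Suc (Suc k)) * real (Suc (Suc k)) = (t gchoose Suc k) * (t - real (Suc k))"
    using gbinomial_mult_1[of t "Suc k"] by (simp add: algebra_simps)
  have "(G' * - u) * r = (G * u) * (q - t)" if "G' * r = G * (t - q)" for G G' u q r :: real
    using that by algebra
  from this[OF rec, of "(-1) ^ k"]
  have "((t gchoose Suc (Suc k)) * (-1) ^ Suc k) * real (Suc (Suc k))
      = ((t gchoose Suc k) * (-1) ^ k) * (real (Suc k) - t)"
    by simp
  also have "\<dots> \<ge> 0"
    using assms by (intro mult_nonneg_nonneg Suc.IH) auto
  finally show ?case
    using mult_less_0_iff not_less of_nat_0_less_iff zero_less_Suc by metis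
qed

lemma pd_cone_one_minus_powr:
  fixes t :: real
  assumes "pd_cone M A" and A: "\<And>x y. 0 \<le> A x y" "\<And>x y. A x y < 1" and t: "0 \<le> t" "t \<le> 1"
  shows "pd_cone M (\<lambda>x y. 1 - (1 - A x y) powr t)"
proof -
  define b where "b k = (t gchoose Suc k) * (-1) ^ k" for k
  have b: "b k \<ge> 0" for k unfolding b_def using signed_gbinomial_nonneg t .
  have sums: "(\<lambda>k. b k * A x y ^ Suc k) sums (1 - (1 - A x y) powr t)" for x y
  proof -
    have "(\<lambda>n. (t gchoose n) * (- A x y) ^ n) sums (1 + - A x y) powr t"
      using A[of x y] by (intro gen_binomial_real) auto
    then have "(\<lambda>n. (t gchoose Suc n) * (- A x y) ^ Suc n) sums ((1 - A x y) powr t - 1)"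
      by (subst sums_Suc_iff) simp
    from sums_minus[OF this] show ?thesis
      by (simp add: b_def power_minus[of "A x y"] mult_ac)
  qed
  show ?thesis
  proof (rule pd_cone_series)
    show "pd_cone M (\<lambda>x y. b k * A x y ^ Suc k)" for k
      using assms(1) b by (intro pd_cone_scale pd_cone_power)
    fix n x y
    have nn: "0 \<le> b k * A x y ^ Suc k" for k using b A by (intro mult_nonneg_nonneg) auto
    have "(\<Sum>k<n. b k * A x y ^ Suc k) \<le> 1 - (1 - A x y) powr t"
      using sum_le_suminf[OF sums_summable[OF sums], of "{..<n}"] nn sums_unique[OF sums]
      by auto
    moreover have "(1 - A x y) powr t \<ge> 0" by simp
    ultimately show "\<bar>\<Sum>k<n. b k * A x y ^ Suc k\<bar> \<le> 1"
      using sum_nonneg[of "{..<n}" "\<lambda>k. b k * A x y ^ Suc k", OF nn] by linarith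
  qed (rule sums)
qed

section \<open>The kernel belongs to the cone\<close>

text \<open>The second \<open>e\<close> in the exponent keeps the exponential strictly below 1 at the origin, where the
  binomial series would otherwise be evaluated on the boundary of its disc of convergence.\<close>

definition regularised_denominator :: "real \<Rightarrow> real \<Rightarrow> real \<Rightarrow> real \<Rightarrow> real \<Rightarrow> real" where
  "regularised_denominator t a e x y =
     1 + (x - y)\<^sup>2 + a * ((1 - exp (- e * (x\<^sup>2 + y\<^sup>2 + e))) / e) powr t"

text \<open>Splitting \<open>(x - y)\<^sup>2\<close> and \<open>1 - S\<close> writes the regularised denominator as
  \<open>h x + h y - Q x y\<close> in the shape required by \<open>pd_cone_reciprocal\<close>.\<close>

lemma pd_cone_regularised:
  assumes t: "0 \<le> t" "t \<le> 1" and "0 \<le> a" "0 < e"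
  shows "pd_cone borel (\<lambda>x y. 1 / regularised_denominator t a e x y)"
proof -
  define b where "b = a * (1 / e) powr t"
  define w where "w x y = exp (- e * (x\<^sup>2 + y\<^sup>2 + e))" for x y :: real
  define S where "S x y = 1 - (1 - w x y) powr t" for x y
  define h where "h x = 1/2 + x\<^sup>2 + b / 2" for x :: real
  define Q where "Q x y = 2 * (x * y) + b * S x y" for x y
  have b: "b \<ge> 0" using assms by (simp add: b_def)
  have w: "0 \<le> w x y" "w x y < 1" for x y
    using assms by (auto simp: w_def add_nonneg_pos)
  have S: "0 \<le> S x y" "S x y \<le> 1" for x y
    using w[of x y] t powr_le1[of t "1 - w x y"] by (auto simp: S_def)
  have "pd_cone borel (\<lambda>x y. exp (- e * (x\<^sup>2 + e/2)) * exp (- e * (y\<^sup>2 + e/2)))"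
    using assms by (intro pd_cone.rank_one[where B = 1]) auto
  moreover have "exp (- e * (x\<^sup>2 + e/2)) * exp (- e * (y\<^sup>2 + e/2)) = w x y" for x y
    unfolding w_def exp_add[symmetric] by (simp add: algebra_simps)
  ultimately have "pd_cone borel w" by simp
  then have cS: "pd_cone borel S"
    unfolding S_def by (intro pd_cone_one_minus_powr w t)
  have h: "h x \<ge> 1/2" and hx: "x\<^sup>2 \<le> 2 * h x" for x using b by (auto simp: h_def)
  have hm: "h \<in> borel_measurable borel" unfolding h_def by measurable
  have denom: "h x + h y - Q x y = regularised_denominator t a e x y" for x y
  proof -
    have "((1 - w x y) / e) powr t = (1 / e) powr t * (1 - w x y) powr t"
      using w[of x y] assms(4) by (simp add: powr_divide powr_mult)
    then show ?thesis
      unfolding regularised_denominator_def w_def[symmetric]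
      by (simp add: h_def Q_def S_def b_def power2_diff algebra_simps)
  qed
  \<comment> \<open>The summand \<open>2 x y\<close> of \<open>Q\<close> is unbounded; only after division by \<open>h x + h y\<close> does it lie in the cone.\<close>
  have "pd_cone borel (\<lambda>x y. 2 * (x * y / (h x + h y)) + b * (S x y * (1 * 1 / (h x + h y))))"
    using h hx b
    by (intro pd_cone.add pd_cone_scale pd_cone_mult cS pd_cone_weighted_Cauchy hm)
       (auto simp: field_simps)
  then have "pd_cone borel (\<lambda>x y. Q x y / (h x + h y))"
    by (simp add: Q_def add_divide_distrib)
  moreover have "\<bar>Q x y\<bar> \<le> h x + h y - 1" for x y
  proof -
    have "0 \<le> (x - y)\<^sup>2" "0 \<le> (x + y)\<^sup>2" by auto
    then have "\<bar>2 * (x * y)\<bar> \<le> x\<^sup>2 + y\<^sup>2" by (simp add: power2_diff power2_sum abs_le_iff)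
    moreover have "0 \<le> b * S x y" "b * S x y \<le> b * 1" using b S[of x y] mult_left_mono[of "S x y" 1 b] by auto
    ultimately show ?thesis by (simp add: Q_def h_def)
  qed
  ultimately have "pd_cone borel (\<lambda>x y. 1 / (h x + h y - Q x y))"
    by (intro pd_cone_reciprocal hm h)
  then show ?thesis by (simp add: denom)
qed

lemma pd_cone_K_kernel:
  assumes t: "0 < t" "t \<le> 1" and a: "0 < a"
  shows "pd_cone borel (K_kernel t a)"
proof -
  let ?R = "\<lambda>n. regularised_denominator t a (1 / real (Suc n))"
  have "pd_cone borel (\<lambda>x y. 1 / (1 + (x - y)\<^sup>2 + a * (x\<^sup>2 + y\<^sup>2) powr t))"
  proof (rule pd_cone.limit)
    show "pd_cone borel (\<lambda>x y. 1 / ?R n x y)" for n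
      using assms by (intro pd_cone_regularised) auto
    have "?R n x y \<ge> 1" for n x y
      using a by (auto simp: regularised_denominator_def intro!: add_nonneg_nonneg)
    then show "\<bar>1 / ?R n x y\<bar> \<le> 1" for n x y
      by (smt (verit) divide_le_eq_1 divide_nonneg_nonneg)
    fix x y :: real
    define r where "r = x\<^sup>2 + y\<^sup>2"
    have "r \<ge> 0" by (simp add: r_def)
    have "((\<lambda>e. (1 - exp (- e * (r + e))) / e) \<longlongrightarrow> r) (at_right 0)"
      by real_asymp
    moreover have "filterlim (\<lambda>n. 1 / real (Suc n)) (at_right 0) sequentially"
      by real_asymp
    ultimately have "(\<lambda>n. (1 - exp (- (1 / real (Suc n)) * (r + 1 / real (Suc n)))) / (1 / real (Suc n)))
        \<longlonglongrightarrow> r"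
      by (rule filterlim_compose)
    then have "(\<lambda>n. ((1 - exp (- (1 / real (Suc n)) * (r + 1 / real (Suc n)))) / (1 / real (Suc n))) powr t)
        \<longlonglongrightarrow> r powr t"
      using t \<open>r \<ge> 0\<close>
      by (intro tendsto_powr2 tendsto_const always_eventually allI divide_nonneg_nonneg) auto
    then have "(\<lambda>n. ?R n x y) \<longlonglongrightarrow> 1 + (x - y)\<^sup>2 + a * (x\<^sup>2 + y\<^sup>2) powr t"
      unfolding regularised_denominator_def r_def
      by (intro tendsto_add tendsto_mult_left tendsto_const)
    moreover have "1 + (x - y)\<^sup>2 + a * (x\<^sup>2 + y\<^sup>2) powr t \<noteq> 0"
      using a by (smt (verit) mult_nonneg_nonneg powr_ge_zero zero_le_power2)
    ultimately show "(\<lambda>n. 1 / ?R n x y) \<longlonglongrightarrow> 1 / (1 + (x - y)\<^sup>2 + a * (x\<^sup>2 + y\<^sup>2) powr t)"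
      by (intro tendsto_intros)
  qed
  from pd_cone_scale[OF this, of "1 / pi"] show ?thesis
    by (simp add: K_kernel_def[abs_def])
qed

section \<open>Quadratic forms of kernels in the cone\<close>

lemma pd_cone_measurable:
  assumes "pd_cone M K"
  shows "case_prod K \<in> borel_measurable (M \<Otimes>\<^sub>M M)"
  using assms
proof induction
  case (rank_one f B)
  then have [measurable]: "f \<in> borel_measurable M" by simp
  show ?case by measurable
next
  case (add K L)
  then have [measurable]: "case_prod K \<in> borel_measurable (M \<Otimes>\<^sub>M M)"
    "case_prod L \<in> borel_measurable (M \<Otimes>\<^sub>M M)" by auto
  show ?case by measurable
next
  case (limit A B K)
  show ?case
    by (rule borel_measurable_LIMSEQ_metric[where f = "\<lambda>n. case_prod (A n)"])
       (use limit in \<open>auto\<close>)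
qed

lemma integrable_tensor:
  fixes c d :: "'b \<Rightarrow> complex"
  assumes "sigma_finite_measure N" and c: "integrable N c" and d: "integrable N d"
  shows "integrable (N \<Otimes>\<^sub>M N) (\<lambda>(x, y). c x * d y)"
proof -
  interpret sigma_finite_measure N by fact
  interpret P: pair_sigma_finite N N ..
  have [measurable]: "c \<in> borel_measurable N" "d \<in> borel_measurable N" using c d by auto
  show ?thesis
  proof (rule P.Fubini_integrable)
    show "integrable N (\<lambda>x. \<integral>y. norm (case (x, y) of (x, y) \<Rightarrow> c x * d y) \<partial>N)"
      using c by (simp add: norm_mult)
    show "AE x in N. integrable N (\<lambda>y. case (x, y) of (x, y) \<Rightarrow> c x * d y)"
      using d by simp
  qed measurable
qed

text \<open>The map \<open>\<phi>\<close> places finite sums over sample points (counting measure on the indices) and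
  integrals (Lebesgue measure, \<open>\<phi>\<close> the identity) under one statement.\<close>

lemma pd_cone_quadratic_form:
  fixes c :: "'b \<Rightarrow> complex" and \<phi> :: "'b \<Rightarrow> 'a"
  assumes "pd_cone M K" and N: "sigma_finite_measure N"
    and [measurable]: "\<phi> \<in> measurable N M" and c: "integrable N c"
  shows "integrable (N \<Otimes>\<^sub>M N) (\<lambda>(x, y). c x * cnj (c y) * K (\<phi> x) (\<phi> y))" (is "integrable _ (?F K)")
    and "(\<integral>(x, y). c x * cnj (c y) * K (\<phi> x) (\<phi> y) \<partial>(N \<Otimes>\<^sub>M N)) \<in> \<real>\<^sub>\<ge>\<^sub>0"
proof -
  interpret sigma_finite_measure N by fact
  interpret P: pair_sigma_finite N N ..
  have [measurable]: "c \<in> borel_measurable N" using c by auto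
  have cc: "integrable (N \<Otimes>\<^sub>M N) (\<lambda>(x, y). c x * cnj (c y))"
    using integrable_tensor[OF N c, of "\<lambda>x. cnj (c x)"] c by simp
  have meas: "?F L \<in> borel_measurable (N \<Otimes>\<^sub>M N)" if "pd_cone M L" for L
  proof -
    have "(\<lambda>p. (\<phi> (fst p), \<phi> (snd p))) \<in> measurable (N \<Otimes>\<^sub>M N) (M \<Otimes>\<^sub>M M)"
      by measurable
    from measurable_compose[OF this pd_cone_measurable[OF that]]
    have [measurable]: "(\<lambda>p. L (\<phi> (fst p)) (\<phi> (snd p))) \<in> borel_measurable (N \<Otimes>\<^sub>M N)"
      by simp
    have "(\<lambda>p. (case p of (x, y) \<Rightarrow> c x * cnj (c y)) * L (\<phi> (fst p)) (\<phi> (snd p)))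
        \<in> borel_measurable (N \<Otimes>\<^sub>M N)"
      using borel_measurable_integrable[OF cc] by measurable
    then show ?thesis by (simp add: split_beta')
  qed
  have bound: "norm (?F L p) \<le> norm (B * (case p of (x, y) \<Rightarrow> c x * cnj (c y)))"
    if "\<And>x y. \<bar>L x y\<bar> \<le> B" for L :: "'a \<Rightarrow> 'a \<Rightarrow> real" and B :: real and p
  proof -
    have "\<bar>L (\<phi> (fst p)) (\<phi> (snd p))\<bar> \<le> \<bar>B\<bar>"
      using that[of "\<phi> (fst p)" "\<phi> (snd p)"] by linarith
    then show ?thesis
      by (auto simp: norm_mult split_beta mult.commute[of _ "\<bar>B\<bar>"]
          mult.commute[of _ "\<bar>L _ _\<bar>"] intro!: mult_right_mono)
  qed
  have int: "integrable (N \<Otimes>\<^sub>M N) (?F L)" if L: "pd_cone M L" for L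
  proof -
    obtain B where B: "\<And>x y. \<bar>L x y\<bar> \<le> B" using pd_cone_bounded[OF L] by blast
    show ?thesis
    proof (rule Bochner_Integration.integrable_bound)
      show "integrable (N \<Otimes>\<^sub>M N) (\<lambda>p. complex_of_real B * (case p of (x, y) \<Rightarrow> c x * cnj (c y)))"
        using cc by simp
      show "?F L \<in> borel_measurable (N \<Otimes>\<^sub>M N)" by (rule meas[OF L])
      show "AE p in N \<Otimes>\<^sub>M N. norm (?F L p) \<le> norm (complex_of_real B * (case p of (x, y) \<Rightarrow> c x * cnj (c y)))"
        by (intro AE_I2 bound B)
    qed
  qed
  show "integrable (N \<Otimes>\<^sub>M N) (?F K)" by (rule int) fact
  show "integral\<^sup>L (N \<Otimes>\<^sub>M N) (?F K) \<in> \<real>\<^sub>\<ge>\<^sub>0" using assms(1)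
  proof induction
    case (rank_one f B)
    define I where "I = (\<integral>x. c x * f (\<phi> x) \<partial>N)"
    have "integral\<^sup>L (N \<Otimes>\<^sub>M N) (?F (\<lambda>x y. f x * f y))
        = (\<integral>x. \<integral>y. (c x * f (\<phi> x)) * cnj (c y * f (\<phi> y)) \<partial>N \<partial>N)"
      using P.integral_fst'[OF int[OF pd_cone.rank_one[OF rank_one]]] by (simp add: mult_ac)
    also have "\<dots> = I * (\<integral>y. cnj (c y * f (\<phi> y)) \<partial>N)"
      by (simp only: integral_mult_right_zero integral_mult_left_zero I_def)
    also have "(\<integral>y. cnj (c y * f (\<phi> y)) \<partial>N) = cnj I"
      unfolding I_def by (rule Bochner_Integration.integral_cnj)
    also have "I * cnj I \<in> \<real>\<^sub>\<ge>\<^sub>0" by (simp add: complex_nonneg_Reals_iff)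
    finally show ?case .
  next
    case (add K L)
    have "integral\<^sup>L (N \<Otimes>\<^sub>M N) (?F (\<lambda>x y. K x y + L x y))
        = (\<integral>p. ?F K p + ?F L p \<partial>(N \<Otimes>\<^sub>M N))"
      by (intro Bochner_Integration.integral_cong) (auto simp: distrib_left)
    also have "\<dots> = integral\<^sup>L (N \<Otimes>\<^sub>M N) (?F K) + integral\<^sup>L (N \<Otimes>\<^sub>M N) (?F L)"
      using add int by (intro Bochner_Integration.integral_add) auto
    finally show ?case using add.IH by simp
  next
    case (limit A B K)
    have "(\<lambda>n. integral\<^sup>L (N \<Otimes>\<^sub>M N) (?F (A n))) \<longlonglongrightarrow> integral\<^sup>L (N \<Otimes>\<^sub>M N) (?F K)"
    proof (rule integral_dominated_convergence)
      show "?F K \<in> borel_measurable (N \<Otimes>\<^sub>M N)"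
        using pd_cone.limit[of M A B K] limit by (intro meas) auto
      show "?F (A n) \<in> borel_measurable (N \<Otimes>\<^sub>M N)" for n using limit by (intro meas) auto
      show "integrable (N \<Otimes>\<^sub>M N) (\<lambda>p. norm (B * (case p of (x, y) \<Rightarrow> c x * cnj (c y))))"
        using cc by simp
      show "AE p in N \<Otimes>\<^sub>M N. norm (?F (A n) p) \<le> norm (B * (case p of (x, y) \<Rightarrow> c x * cnj (c y)))" for n
        using bound[of "A n" B] limit(2) by (intro AE_I2) simp
      show "AE p in N \<Otimes>\<^sub>M N. (\<lambda>n. ?F (A n) p) \<longlonglongrightarrow> ?F K p"
        using limit(3) by (auto intro!: AE_I2 tendsto_mult tendsto_of_real tendsto_const split: prod.split)
    qed
    then show ?case
      by (rule Lim_in_closed_set[OF closed_nonneg_Reals_complex, rotated -1]) (use limit in auto)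
  qed
qed

lemma pd_cone_imp_positive_definite_kernel:
  assumes K: "pd_cone borel K"
  shows "positive_definite_kernel (\<lambda>x y. complex_of_real (K x y))"
  unfolding positive_definite_kernel_def
proof (intro allI impI)
  fix n :: nat and x :: "nat \<Rightarrow> 'a::topological_space" and c :: "nat \<Rightarrow> complex"
  let ?N = "count_space {1..n}"
  have N: "sigma_finite_measure ?N" by (simp add: sigma_finite_measure_count_space_finite)
  interpret sigma_finite_measure ?N by (rule N)
  interpret P: pair_sigma_finite ?N ?N ..
  have c: "integrable ?N c" by (rule integrable_count_space) simp
  note q = pd_cone_quadratic_form[OF K N _ c, of x]
  have x: "x \<in> measurable ?N borel" by simp
  have "(\<integral>(j, k). c j * cnj (c k) * K (x j) (x k) \<partial>(?N \<Otimes>\<^sub>M ?N))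
      = (\<Sum>j=1..n. \<Sum>k=1..n. c j * cnj (c k) * K (x j) (x k))"
    using P.integral_fst'[OF q(1)[OF x]]
    by (simp add: lebesgue_integral_count_space_finite)
  then show "(\<Sum>j=1..n. \<Sum>k=1..n. c j * cnj (c k) * complex_of_real (K (x j) (x k))) \<in> \<real>\<^sub>\<ge>\<^sub>0"
    using q(2)[OF x] by simp
qed

section \<open>Operators dominated by convolution with a probability density\<close>

text \<open>A kernel bounded by \<open>g (x - y)\<close>, with \<open>g\<close> a bounded probability density, acts on
  square-integrable functions: averaging against a translate of \<open>g\<close> does not increase the integral
  of the square. Everything reduces to the integrability of \<open>g (x - y) \<bar>c y\<bar>\<^sup>2\<close> on the plane.\<close>

context
  fixes g :: "real \<Rightarrow> real" and C :: real
  assumes g_int: "integrable lborel g" and g_one: "integral\<^sup>L lborel g = 1"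
    and g_nonneg: "\<And>z. 0 \<le> g z" and g_le: "\<And>z. g z \<le> C"
begin

lemma translates_integrable:
  "integrable lborel (\<lambda>x. g (x - y))" "integrable lborel (\<lambda>y. g (x - y))"
  "(\<integral>x. g (x - y) \<partial>lborel) = 1" "(\<integral>y. g (x - y) \<partial>lborel) = 1"
  using lborel_integrable_real_affine[OF g_int, of 1 "-y"] lborel_integral_real_affine[of 1 g "-y"]
    lborel_integrable_real_affine[OF g_int, of "-1" x] lborel_integral_real_affine[of "-1" g x] g_one
  by (simp_all add: add.commute)

lemma g_measurable: "g \<in> borel_measurable borel"
  using borel_measurable_integrable[OF g_int] by simp

lemma weighted_square_integrable:
  assumes "c \<in> L2"
  shows "integrable (lborel \<Otimes>\<^sub>M lborel) (\<lambda>(x, y). g (x - y) * (cmod (c x))\<^sup>2)"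
    and "integrable (lborel \<Otimes>\<^sub>M lborel) (\<lambda>(x, y). g (x - y) * (cmod (c y))\<^sup>2)"
proof -
  note [measurable] = g_measurable
  have [measurable]: "c \<in> borel_measurable borel" and c: "integrable lborel (\<lambda>x. (cmod (c x))\<^sup>2)"
    using assms by (auto simp: L2_def)
  show "integrable (lborel \<Otimes>\<^sub>M lborel) (\<lambda>(x, y). g (x - y) * (cmod (c x))\<^sup>2)"
    by (rule lborel_pair.Fubini_integrable)
       (auto simp: abs_mult g_nonneg translates_integrable c)
  have "integrable (lborel \<Otimes>\<^sub>M lborel) (\<lambda>(x, y). g (y - x) * (cmod (c x))\<^sup>2)"
    by (rule lborel_pair.Fubini_integrable)
       (auto simp: abs_mult g_nonneg translates_integrable c)
  from lborel_pair.integrable_product_swap[OF this]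
  show "integrable (lborel \<Otimes>\<^sub>M lborel) (\<lambda>(x, y). g (x - y) * (cmod (c y))\<^sup>2)"
    by simp
qed

text \<open>The inequality is Jensen's, in the form that a variance is nonnegative: with \<open>m\<close> the mean of
  \<open>\<bar>c\<bar>\<close> under the density \<open>g (x - y)\<close>, expand the mean of \<open>(\<bar>c\<bar> - m)\<^sup>2\<close>.\<close>

lemma weighted_average_integrable:
  assumes "c \<in> L2"
  shows "integrable lborel (\<lambda>y. g (x - y) * (cmod (c y))\<^sup>2)"
    and "integrable lborel (\<lambda>y. g (x - y) * cmod (c y))"
    and "(\<integral>y. g (x - y) * cmod (c y) \<partial>lborel)\<^sup>2 \<le> (\<integral>y. g (x - y) * (cmod (c y))\<^sup>2 \<partial>lborel)"
proof -
  note [measurable] = g_measurable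
  have [measurable]: "c \<in> borel_measurable borel" and c: "integrable lborel (\<lambda>x. (cmod (c x))\<^sup>2)"
    using assms by (auto simp: L2_def)
  show 2: "integrable lborel (\<lambda>y. g (x - y) * (cmod (c y))\<^sup>2)"
    by (rule Bochner_Integration.integrable_bound[OF integrable_mult_right[OF c, of C]])
       (auto intro!: AE_I2 mult_right_mono simp: abs_mult g_nonneg intro: order_trans[OF g_le])
  show 1: "integrable lborel (\<lambda>y. g (x - y) * cmod (c y))"
  proof (rule Bochner_Integration.integrable_bound)
    show "integrable lborel (\<lambda>y. g (x - y) + g (x - y) * (cmod (c y))\<^sup>2)"
      using 2 translates_integrable by simp
    have "s \<le> 1 + s\<^sup>2" for s :: real
      using sum_power2_ge_zero[of "s - 1/2" 0] by (simp add: power2_eq_square field_simps)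
    then have "g (x - y) * cmod (c y) \<le> g (x - y) * (1 + (cmod (c y))\<^sup>2)" for y
      by (intro mult_left_mono g_nonneg)
    then show "AE y in lborel. norm (g (x - y) * cmod (c y))
        \<le> norm (g (x - y) + g (x - y) * (cmod (c y))\<^sup>2)"
      using g_nonneg by (intro AE_I2) (simp add: abs_mult distrib_left)
  qed measurable
  define m where "m = (\<integral>y. g (x - y) * cmod (c y) \<partial>lborel)"
  have "0 \<le> (\<integral>y. g (x - y) * (cmod (c y) - m)\<^sup>2 \<partial>lborel)"
    by (intro Bochner_Integration.integral_nonneg mult_nonneg_nonneg g_nonneg) auto
  also have "\<dots> = (\<integral>y. g (x - y) * (cmod (c y))\<^sup>2 - 2 * m * (g (x - y) * cmod (c y))
      + m\<^sup>2 * g (x - y) \<partial>lborel)"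
    by (intro Bochner_Integration.integral_cong) (auto simp: power2_eq_square algebra_simps)
  also have "\<dots> = (\<integral>y. g (x - y) * (cmod (c y))\<^sup>2 \<partial>lborel) - 2 * m * m + m\<^sup>2"
    using 1 2 translates_integrable by (simp add: m_def)
  finally show "m\<^sup>2 \<le> (\<integral>y. g (x - y) * (cmod (c y))\<^sup>2 \<partial>lborel)"
    by (simp add: power2_eq_square)
qed

lemma dominated_kernel_section_integrable:
  assumes [measurable]: "case_prod K \<in> borel_measurable (borel \<Otimes>\<^sub>M borel)"
    and K: "\<And>x y. \<bar>K x y\<bar> \<le> g (x - y)" and c: "c \<in> L2"
  shows "integrable lborel (\<lambda>y. complex_of_real (K x y) * c y)"
proof (rule Bochner_Integration.integrable_bound[OF weighted_average_integrable(2)[OF c, of x]])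
  have [measurable]: "c \<in> borel_measurable borel" using c by (auto simp: L2_def)
  show "(\<lambda>y. complex_of_real (K x y) * c y) \<in> borel_measurable lborel" by measurable
  show "AE y in lborel. norm (complex_of_real (K x y) * c y) \<le> norm (g (x - y) * cmod (c y))"
    using g_nonneg by (intro AE_I2) (auto simp: norm_mult intro!: mult_right_mono K)
qed

lemma dominated_kernel_defines_operator:
  assumes meas [measurable]: "case_prod K \<in> borel_measurable (borel \<Otimes>\<^sub>M borel)"
    and K: "\<And>x y. \<bar>K x y\<bar> \<le> g (x - y)"
  shows "defines_operator_on_L2 (\<lambda>x y. complex_of_real (K x y))"
  unfolding defines_operator_on_L2_def
proof (intro ballI conjI)
  fix c assume c: "c \<in> L2"
  have [measurable]: "c \<in> borel_measurable borel" using c by (auto simp: L2_def)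
  note sec = dominated_kernel_section_integrable[OF meas K c]
  show "AE x in lborel. integrable lborel (\<lambda>y. complex_of_real (K x y) * c y)"
    using sec by simp
  let ?T = "integral_operator (\<lambda>x y. complex_of_real (K x y)) c"
  have T [measurable]: "?T \<in> borel_measurable borel"
    unfolding integral_operator_def by measurable
  have "(cmod (?T x))\<^sup>2 \<le> (\<integral>y. g (x - y) * (cmod (c y))\<^sup>2 \<partial>lborel)" for x
  proof -
    have "cmod (?T x) \<le> (\<integral>y. cmod (complex_of_real (K x y) * c y) \<partial>lborel)"
      unfolding integral_operator_def by (rule integral_norm_bound)
    also have "\<dots> \<le> (\<integral>y. g (x - y) * cmod (c y) \<partial>lborel)"
      using sec[of x] weighted_average_integrable(2)[OF c, of x]
      by (intro integral_mono integrable_norm) (auto simp: norm_mult intro!: mult_right_mono K)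
    finally have "(cmod (?T x))\<^sup>2 \<le> (\<integral>y. g (x - y) * cmod (c y) \<partial>lborel)\<^sup>2"
      by (intro power_mono) auto
    also have "\<dots> \<le> (\<integral>y. g (x - y) * (cmod (c y))\<^sup>2 \<partial>lborel)"
      by (rule weighted_average_integrable(3)[OF c])
    finally show ?thesis .
  qed
  then have "AE x in lborel. norm ((cmod (?T x))\<^sup>2)
      \<le> norm (\<integral>y. g (x - y) * (cmod (c y))\<^sup>2 \<partial>lborel)"
    by (intro AE_I2) (auto intro: order_trans[OF _ abs_ge_self])
  then have "integrable lborel (\<lambda>x. (cmod (?T x))\<^sup>2)"
  proof (rule Bochner_Integration.integrable_bound[rotated 2])
    show "integrable lborel (\<lambda>x. \<integral>y. g (x - y) * (cmod (c y))\<^sup>2 \<partial>lborel)"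
      using lborel_pair.integrable_fst'[OF weighted_square_integrable(2)[OF c]]
      by (simp only: prod.case)
    show "(\<lambda>x. (cmod (?T x))\<^sup>2) \<in> borel_measurable lborel"
      using T by measurable
  qed
  then show "?T \<in> L2" by (simp add: L2_def)
qed

text \<open>By the inequality \<open>2 u v \<le> u\<^sup>2 + v\<^sup>2\<close> the integrand is dominated by the two integrable functions
  \<open>g (x - y) \<bar>c x\<bar>\<^sup>2\<close> and \<open>g (x - y) \<bar>c y\<bar>\<^sup>2\<close>. The conjugate stands on the first variable, as in
  the inner product of the image of \<open>c\<close> with \<open>c\<close>.\<close>

lemma dominated_kernel_form_integrable:
  assumes [measurable]: "case_prod K \<in> borel_measurable (borel \<Otimes>\<^sub>M borel)"
    and K: "\<And>x y. \<bar>K x y\<bar> \<le> g (x - y)" and c: "c \<in> L2"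
  shows "integrable (lborel \<Otimes>\<^sub>M lborel) (\<lambda>(x, y). cnj (c x) * c y * complex_of_real (K x y))"
proof (rule Bochner_Integration.integrable_bound)
  have [measurable]: "c \<in> borel_measurable borel" using c by (auto simp: L2_def)
  have [measurable]: "(\<lambda>x. cnj (c x)) \<in> borel_measurable borel"
    by (rule borel_measurable_continuous_on[OF continuous_on_cnj[OF continuous_on_id]]) simp
  show "(\<lambda>(x, y). cnj (c x) * c y * complex_of_real (K x y)) \<in> borel_measurable (lborel \<Otimes>\<^sub>M lborel)"
    by measurable
  show "integrable (lborel \<Otimes>\<^sub>M lborel)
      (\<lambda>p. (case p of (x, y) \<Rightarrow> g (x - y) * (cmod (c x))\<^sup>2) + (case p of (x, y) \<Rightarrow> g (x - y) * (cmod (c y))\<^sup>2))"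
    by (intro Bochner_Integration.integrable_add weighted_square_integrable c)
  have "norm (cnj (c x) * c y * complex_of_real (K x y))
      \<le> g (x - y) * (cmod (c x))\<^sup>2 + g (x - y) * (cmod (c y))\<^sup>2" for x y
  proof -
    have "2 * (cmod (c x) * cmod (c y)) \<le> (cmod (c x))\<^sup>2 + (cmod (c y))\<^sup>2"
      using sum_squares_bound[of "cmod (c x)" "cmod (c y)"] by simp
    moreover have "0 \<le> cmod (c x) * cmod (c y)" by simp
    ultimately have "cmod (c x) * cmod (c y) \<le> (cmod (c x))\<^sup>2 + (cmod (c y))\<^sup>2" by linarith
    then have "\<bar>K x y\<bar> * (cmod (c x) * cmod (c y)) \<le> g (x - y) * ((cmod (c x))\<^sup>2 + (cmod (c y))\<^sup>2)"
      by (intro mult_mono K g_nonneg) auto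
    then show ?thesis by (simp add: norm_mult algebra_simps)
  qed
  then show "AE p in lborel \<Otimes>\<^sub>M lborel. norm (case p of (x, y) \<Rightarrow> cnj (c x) * c y * complex_of_real (K x y))
      \<le> norm ((case p of (x, y) \<Rightarrow> g (x - y) * (cmod (c x))\<^sup>2) + (case p of (x, y) \<Rightarrow> g (x - y) * (cmod (c y))\<^sup>2))"
    by (intro AE_I2) (auto intro: order_trans[OF _ abs_ge_self])
qed

end

lemma Cauchy_density:
  "integrable lborel (\<lambda>z::real. 1 / (pi * (1 + z\<^sup>2)))"
  "(\<integral>z. 1 / (pi * (1 + z\<^sup>2)) \<partial>lborel) = 1"
proof -
  have i: "integrable lborel (\<lambda>z::real. inverse (1 + z\<^sup>2))"
    using integrable_inverse_1_plus_square by (simp add: set_integrable_def)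
  have v: "(\<integral>z. inverse (1 + z\<^sup>2) \<partial>lborel) = pi"
    using LBINT_inverse_1_plus_square
    by (simp add: interval_lebesgue_integral_def set_lebesgue_integral_def)
  have *: "1 / (pi * (1 + z\<^sup>2)) = 1 / pi * inverse (1 + z\<^sup>2)" for z :: real
    by (simp add: field_simps)
  show "integrable lborel (\<lambda>z::real. 1 / (pi * (1 + z\<^sup>2)))"
    unfolding * using i by simp
  show "(\<integral>z. 1 / (pi * (1 + z\<^sup>2)) \<partial>lborel) = 1"
    unfolding * integral_mult_right_zero v by simp
qed


section \<open>Positivity of the operator and the theorem\<close>

text \<open>A square-integrable function need not be integrable, so the quadratic form is first evaluated on its
  truncations to \<open>[-n, n]\<close>, with coefficient function \<open>cnj \<circ> c\<close> to match the position of the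
  conjugate; the untruncated integrand is the dominating function for the limit.\<close>

lemma pd_cone_imp_positive_definite_operator:
  assumes g: "integrable lborel g" "integral\<^sup>L lborel g = 1" "\<And>z. 0 \<le> g z" "\<And>z. g z \<le> C"
    and cone: "pd_cone borel K" and K: "\<And>x y. \<bar>K x y\<bar> \<le> g (x - y)"
  shows "positive_definite_operator (integral_operator (\<lambda>x y. complex_of_real (K x y)))"
  unfolding positive_definite_operator_def
proof
  fix c assume c: "c \<in> L2"
  have cm [measurable]: "c \<in> borel_measurable borel" and c2: "integrable lborel (\<lambda>x. (cmod (c x))\<^sup>2)"
    using c by (auto simp: L2_def)
  have cnj_m [measurable]: "(\<lambda>x. cnj (c x)) \<in> borel_measurable borel"
    by (rule borel_measurable_continuous_on[OF continuous_on_cnj[OF continuous_on_id]]) simp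
  let ?K = "\<lambda>x y. complex_of_real (K x y)"
  define \<Psi> where "\<Psi> = (\<lambda>(x, y). cnj (c x) * c y * ?K x y)"
  define cut where "cut n x = indicat_real {- real n..real n} x" for n x
  have \<Psi>: "integrable (lborel \<Otimes>\<^sub>M lborel) \<Psi>"
    unfolding \<Psi>_def using dominated_kernel_form_integrable[OF g _ K c] pd_cone_measurable[OF cone] by simp
  let ?\<Psi> = "\<lambda>n p. \<Psi> p * (cut n (fst p) * cut n (snd p))"
  have "integral\<^sup>L (lborel \<Otimes>\<^sub>M lborel) (?\<Psi> n) \<in> \<real>\<^sub>\<ge>\<^sub>0" for n
  proof -
    have int: "integrable lborel (\<lambda>x. cnj (c x) * cut n x)"
    proof (rule Bochner_Integration.integrable_bound)
      have "integrable lborel (cut n)"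
        unfolding cut_def by (intro integrable_real_indicator) (auto simp: emeasure_lborel_Icc_eq)
      then show "integrable lborel (\<lambda>x. cut n x + (cmod (c x))\<^sup>2)"
        by (intro Bochner_Integration.integrable_add c2)
      show "(\<lambda>x. cnj (c x) * cut n x) \<in> borel_measurable lborel"
        unfolding cut_def by measurable
      have "s \<le> 1 + s\<^sup>2" for s :: real
        using sum_power2_ge_zero[of "s - 1/2" 0] by (simp add: power2_eq_square field_simps)
      then show "AE x in lborel. norm (cnj (c x) * cut n x) \<le> norm (cut n x + (cmod (c x))\<^sup>2)"
        by (intro AE_I2) (auto simp: cut_def norm_mult indicator_def)
    qed
    have "(\<integral>(x, y). cnj (c x) * cut n x * cnj (cnj (c y) * cut n y) * ?K x y \<partial>(lborel \<Otimes>\<^sub>M lborel)) \<in> \<real>\<^sub>\<ge>\<^sub>0"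
      using pd_cone_quadratic_form(2)[OF cone lborel.sigma_finite_measure_axioms _ int, of "\<lambda>x. x"] by simp
    also have "(\<lambda>(x, y). cnj (c x) * cut n x * cnj (cnj (c y) * cut n y) * ?K x y) = ?\<Psi> n"
      by (auto simp: \<Psi>_def fun_eq_iff mult_ac)
    finally show ?thesis .
  qed
  moreover have "(\<lambda>n. integral\<^sup>L (lborel \<Otimes>\<^sub>M lborel) (?\<Psi> n)) \<longlonglongrightarrow> integral\<^sup>L (lborel \<Otimes>\<^sub>M lborel) \<Psi>"
  proof (rule integral_dominated_convergence)
    have [measurable]: "\<Psi> \<in> borel_measurable (lborel \<Otimes>\<^sub>M lborel)" using \<Psi> by auto
    show "\<Psi> \<in> borel_measurable (lborel \<Otimes>\<^sub>M lborel)" by fact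
    show "?\<Psi> n \<in> borel_measurable (lborel \<Otimes>\<^sub>M lborel)" for n
      unfolding cut_def by measurable
    show "integrable (lborel \<Otimes>\<^sub>M lborel) (\<lambda>p. norm (\<Psi> p))" using \<Psi> by simp
    show "AE p in lborel \<Otimes>\<^sub>M lborel. norm (?\<Psi> n p) \<le> norm (\<Psi> p)" for n
      by (intro AE_I2) (auto simp: cut_def indicator_def)
    have "(\<lambda>n. ?\<Psi> n (x, y)) \<longlonglongrightarrow> \<Psi> (x, y)" for x y
    proof (rule tendsto_eventually)
      obtain m :: nat where "max \<bar>x\<bar> \<bar>y\<bar> \<le> real m" using real_arch_simple by blast
      then show "eventually (\<lambda>n. ?\<Psi> n (x, y) = \<Psi> (x, y)) sequentially"
        by (intro eventually_sequentiallyI[of m]) (auto simp: cut_def indicator_def)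
    qed
    then show "AE p in lborel \<Otimes>\<^sub>M lborel. (\<lambda>n. ?\<Psi> n p) \<longlonglongrightarrow> \<Psi> p"
      by (intro AE_I2) (auto split: prod.split)
  qed
  ultimately have "integral\<^sup>L (lborel \<Otimes>\<^sub>M lborel) \<Psi> \<in> \<real>\<^sub>\<ge>\<^sub>0"
    by (intro Lim_in_closed_set[OF closed_nonneg_Reals_complex]) auto
  moreover have "L2_inner (integral_operator ?K c) c = integral\<^sup>L (lborel \<Otimes>\<^sub>M lborel) \<Psi>"
  proof -
    have "(\<integral>y. ?K x y * c y \<partial>lborel) * cnj (c x) = (\<integral>y. \<Psi> (x, y) \<partial>lborel)" for x
      by (subst integral_mult_left_zero[symmetric]) (simp add: \<Psi>_def mult_ac)
    then have "L2_inner (integral_operator ?K c) c = (\<integral>x. \<integral>y. \<Psi> (x, y) \<partial>lborel \<partial>lborel)"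
      by (simp add: L2_inner_def integral_operator_def)
    then show ?thesis using lborel_pair.integral_fst'[OF \<Psi>] by simp
  qed
  ultimately show "L2_inner (integral_operator ?K c) c \<in> \<real>\<^sub>\<ge>\<^sub>0" by simp
qed

theorem proposition1:
  fixes t a :: real
  assumes "0 < t" and "t \<le> 1" and "0 < a"
  shows "positive_definite_kernel (\<lambda>x y. complex_of_real (K_kernel t a x y)) \<and>
         defines_operator_on_L2 (\<lambda>x y. complex_of_real (K_kernel t a x y)) \<and>
         positive_definite_operator (integral_operator (\<lambda>x y. complex_of_real (K_kernel t a x y)))"
proof -
  define g where "g z = 1 / (pi * (1 + z\<^sup>2))" for z :: real
  have g: "integrable lborel g" "integral\<^sup>L lborel g = 1" "\<And>z. 0 \<le> g z" "\<And>z. g z \<le> 1 / pi"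
    using Cauchy_density unfolding g_def by (auto intro!: divide_left_mono mult_pos_pos add_pos_nonneg)
  have K: "\<bar>K_kernel t a x y\<bar> \<le> g (x - y)" for x y
  proof -
    have "0 \<le> a * (x\<^sup>2 + y\<^sup>2) powr t" using assms by simp
    moreover have "0 < 1 + (x - y)\<^sup>2" by (simp add: add_pos_nonneg)
    ultimately show ?thesis by (simp add: K_kernel_def g_def frac_le mult_left_mono)
  qed
  have cone: "pd_cone borel (K_kernel t a)" by (rule pd_cone_K_kernel[OF assms])
  show ?thesis
    using pd_cone_imp_positive_definite_kernel[OF cone]
      dominated_kernel_defines_operator[OF g pd_cone_measurable[OF cone] K]
      pd_cone_imp_positive_definite_operator[OF g cone K]
    by blast
qed

end
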